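(* Let $\mathfrak{v}=\{\nu_i\}_{i\in I}$ be a totally ordered set in $\mathcal{V}$ such that $\mathfrak{v}$ has no maximum and there is at least one polynomial in $\mathbb{K}[x]$ that is not $\mathfrak{v}$-stable. For $\mathfrak{v}$-stable $f$ write $\mathfrak{v}(f)=\nu_{i_f}(f)$, the eventual value. Let $Q$ be a monic polynomial of smallest degree that is not $\mathfrak{v}$-stable, and take $\gamma\in\Gamma_\infty$ such that $\gamma>\nu_i(Q)$ for every $i\in I$. Consider the map $\mu:\mathbb{K}[x]\to\Gamma_\infty$, $$\mu(f_0+f_1Q+\cdots+f_rQ^r)=\min_{0\le j\le r}\{\mathfrak{v}(f_j)+j\gamma\},$$ where $f_0+f_1Q+\cdots+f_rQ^r$ is the $Q$-expansion of $f$. Then: 1. $\mu\in\mathcal{V}$. 2. $\nu_i<\mu$ for every $i\in I$. 3. $\mu=\mu_Q$ (the truncation of $\mu$ at $Q$), and $Q$ is a key polynomial for $\mu$.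
   Context: A valuation on a commutative ring $A$ with unity is a map $\nu:A\to\Gamma_\infty=\Gamma\cup\{\infty\}$, with $\Gamma$ a totally ordered abelian group, such that $\nu(ab)=\nu(a)+\nu(b)$, $\nu(a+b)\ge\min\{\nu(a),\nu(b)\}$, $\nu(1)=0$, $\nu(0)=\infty$ (non-zero elements may have value $\infty$). Let $\mathbb{K}$ be a field, $\nu_0$ a valuation on $\mathbb{K}$ with value group $\Gamma_0$ (taking the value $\infty$ only at $0$), and fix a totally ordered divisible abelian group $\Gamma\supseteq\Gamma_0$. Put $\mathcal{V}=\{\nu_0\}\cup\{\nu:\mathbb{K}[x]\to\Gamma_\infty\mid \nu\text{ is a valuation extending }\nu_0\}$, partially ordered by $\nu_0\le\nu$ for all $\nu\in\mathcal{V}$, and, for $\nu,\mu\in\mathcal{V}\setminus\{\nu_0\}$, $\nu\le\mu$ iff $\nu(f)\le\mu(f)$ for all $f\in\mathbb{K}[x]$; $\nu<\mu$ means $\nu\le\mu$ and $\nu(g)<\mu(g)$ for some $g\in\mathbb{K}[x]$. The families $\mathfrak{v}=\{\nu_i\}_{i\in I}$ considered are non-empty and consist of valuations on $\mathbb{K}[x]$; $I$ carries the induced total order ($i\le j$ iff $\nu_i\le\nu_j$). A polynomial $f\in\mathbb{K}[x]$ is $\mathfrak{v}$-stable if there is $i_f\in I$ with $\nu_i(f)=\nu_{i_f}(f)$ for every $i\in I$ with $i\ge i_f$. For a non-constant $q\in\mathbb{K}[x]$, the $q$-expansion of $f$ is the unique expression $f=f_0+f_1q+\cdots+f_sq^s$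 with $\deg(f_i)<\deg(q)$ for all $i$. The truncation of a valuation $\nu$ on $\mathbb{K}[x]$ at $q$ is $\nu_q(f)=\min_{0\le i\le s}\{\nu(f_iq^i)\}$. Key polynomials: let $\nu$ be a valuation on $\mathbb{K}[x]$, $\overline{\mathbb{K}}$ an algebraic closure of $\mathbb{K}$ and $\overline{\nu}$ a valuation on $\overline{\mathbb{K}}[x]$ extending $\nu$. For non-zero $f$ put $\delta(f)=\max\{\overline{\nu}(x-a)\mid a\in\overline{\mathbb{K}},\ f(a)=0\}$ if $\deg(f)>0$ and $\delta(f)=-\infty$ if $\deg(f)=0$; this is independent of the choices. A monic $Q\in\mathbb{K}[x]$ is a key polynomial for $\nu$ if for every non-zero $f\in\mathbb{K}[x]$, $\delta(f)\ge\delta(Q)$ implies $\deg(f)\ge\deg(Q)$. *)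

theory Defs
  imports
    "HOL-Library.Extended"
    "HOL-Algebra.Algebraic_Closure_Type"
begin

class divisible_linordered_ab_group_add = linordered_ab_group_add +
  assumes divisible: "0 < n \<Longrightarrow> \<exists>y. (\<Sum>k<(n::nat). y) = x"

text \<open>
  The set \<open>\<Gamma> \<union> {\<infinity>}\<close> is the part of \<open>'g extended\<close> without \<open>Minf\<close>; the element \<open>Minf\<close> is
  only used for the value \<open>-\<infinity>\<close> of \<open>\<delta>\<close> below.
\<close>

definition is_valuation :: "('r::comm_ring_1 \<Rightarrow> 'g::linordered_ab_group_add extended) \<Rightarrow> bool" where
  "is_valuation \<nu> \<longleftrightarrow>
     (\<forall>a. \<nu> a \<noteq> Minf) \<and>
     (\<forall>a b. \<nu> (a * b) = \<nu> a + \<nu> b) \<and>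
     (\<forall>a b. \<nu> (a + b) \<ge> min (\<nu> a) (\<nu> b)) \<and>
     \<nu> 1 = 0 \<and> \<nu> 0 = Pinf"

text \<open>
  The valuations on \<open>K[x]\<close> extending \<open>\<nu>0\<close>. This is the poset \<open>\<V>\<close> without its formally adjoined
  least element \<open>\<nu>0\<close>, which is a map on \<open>K\<close> and not on \<open>K[x]\<close>. The order of \<open>\<V>\<close> is the library's
  pointwise order of functions.
\<close>

definition extensions ::
    "('a::field \<Rightarrow> 'g::linordered_ab_group_add extended) \<Rightarrow> ('a poly \<Rightarrow> 'g extended) set" where
  "extensions \<nu>0 = {\<nu>. is_valuation \<nu> \<and> (\<forall>a. \<nu> [:a:] = \<nu>0 a)}"

definition eventually_stable :: "('a::zero poly \<Rightarrow> 'g::order) set \<Rightarrow> 'a poly \<Rightarrow> bool" where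
  "eventually_stable \<vv> f \<longleftrightarrow> (\<exists>\<nu>f\<in>\<vv>. \<forall>\<nu>\<in>\<vv>. \<nu>f \<le> \<nu> \<longrightarrow> \<nu> f = \<nu>f f)"

definition eventual_value :: "('a::zero poly \<Rightarrow> 'g::order) set \<Rightarrow> 'a poly \<Rightarrow> 'g" where
  "eventual_value \<vv> f = (THE y. \<exists>\<nu>f\<in>\<vv>. y = \<nu>f f \<and> (\<forall>\<nu>\<in>\<vv>. \<nu>f \<le> \<nu> \<longrightarrow> \<nu> f = \<nu>f f))"

lemma eventual_value_eq:
  assumes chain: "\<forall>\<nu>\<in>\<vv>. \<forall>\<nu>'\<in>\<vv>. \<nu> \<le> \<nu>' \<or> \<nu>' \<le> \<nu>"
    and \<nu>f: "\<nu>f \<in> \<vv>" "\<forall>\<nu>\<in>\<vv>. \<nu>f \<le> \<nu> \<longrightarrow> \<nu> f = \<nu>f f"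
  shows "eventual_value \<vv> f = \<nu>f f"
  unfolding eventual_value_def
proof (rule the_equality)
  show "\<exists>\<nu>g\<in>\<vv>. \<nu>f f = \<nu>g f \<and> (\<forall>\<nu>\<in>\<vv>. \<nu>g \<le> \<nu> \<longrightarrow> \<nu> f = \<nu>g f)"
    using \<nu>f by blast
next
  fix y assume "\<exists>\<nu>g\<in>\<vv>. y = \<nu>g f \<and> (\<forall>\<nu>\<in>\<vv>. \<nu>g \<le> \<nu> \<longrightarrow> \<nu> f = \<nu>g f)"
  then show "y = \<nu>f f" using chain \<nu>f by metis
qed

text \<open>
  The expression \<open>f\<^sub>0 + f\<^sub>1 q + \<dots> + f\<^sub>s q\<^sup>s\<close> is encoded as the polynomial with coefficients
  \<open>f\<^sub>j \<in> K[x]\<close>, evaluated at \<open>q\<close>. With \<open>degree 0 = 0\<close> a zero coefficient is allowed since \<open>q\<close>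
  is non-constant.
\<close>

definition q_expansion :: "'a::field poly \<Rightarrow> 'a poly \<Rightarrow> 'a poly poly" where
  "q_expansion q f =
     (THE c. poly c q = f \<and> (\<forall>j. Polynomial.degree (Polynomial.coeff c j) < Polynomial.degree q))"

lemma q_expansion_ex1:
  fixes f q :: "'a::field poly"
  assumes q: "0 < Polynomial.degree q"
  shows "\<exists>!c. poly c q = f \<and> (\<forall>j. Polynomial.degree (Polynomial.coeff c j) < Polynomial.degree q)"
proof (rule ex_ex1I)
  have q0: "q \<noteq> 0" using q by auto
  show "\<exists>c. poly c q = f \<and> (\<forall>j. Polynomial.degree (Polynomial.coeff c j) < Polynomial.degree q)"
  proof (induction "Polynomial.degree f" arbitrary: f rule: less_induct)
    case less
    show ?case
    proof (cases "Polynomial.degree f < Polynomial.degree q")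
      case True
      then show ?thesis
        using q by (intro exI[of _ "[:f:]"]) (auto simp: coeff_pCons split: nat.splits)
    next
      case False
      have r: "Polynomial.degree (f mod q) < Polynomial.degree q"
        using q q0 degree_mod_less[of q f] by auto
      have "Polynomial.degree (f div q) < Polynomial.degree f"
      proof (cases "f div q = 0")
        case True
        with False q show ?thesis by simp
      next
        case nz: False
        have "f div q * q = f - f mod q" by (simp add: minus_mod_eq_div_mult)
        then have "Polynomial.degree (f div q * q) \<le> Polynomial.degree f"
          using r False by (metis degree_diff_le le_refl less_imp_le not_less order_trans)
        with nz q0 q show ?thesis by (simp add: degree_mult_eq)
      qed
      then obtain c where c: "poly c q = f div q"
        "\<forall>j. Polynomial.degree (Polynomial.coeff c j) < Polynomial.degree q"
        using less by blast
      with c r show ?thesis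
        by (intro exI[of _ "pCons (f mod q) c"]) (auto simp: coeff_pCons split: nat.splits)
    qed
  qed
  have zero: "e = 0"
    if "poly e q = 0" "\<forall>j. Polynomial.degree (Polynomial.coeff e j) < Polynomial.degree q" for e
    using that
  proof (induction e)
    case (pCons a e)
    have a: "Polynomial.degree a < Polynomial.degree q"
      using pCons.prems(2)[rule_format, of 0] by simp
    have eq: "a = - (q * poly e q)"
      using pCons.prems(1) by (simp add: add_eq_0_iff)
    have "poly e q = 0"
    proof (rule ccontr)
      assume "poly e q \<noteq> 0"
      then have "Polynomial.degree q \<le> Polynomial.degree a"
        using q0 by (simp add: eq degree_mult_eq)
      with a show False by simp
    qed
    moreover have "Polynomial.degree (Polynomial.coeff e j) < Polynomial.degree q" for j
      using pCons.prems(2)[rule_format, of "Suc j"] by simp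
    ultimately show ?case using pCons.IH eq by simp
  qed simp
  fix c d
  assume "poly c q = f \<and> (\<forall>j. Polynomial.degree (Polynomial.coeff c j) < Polynomial.degree q)"
    and "poly d q = f \<and> (\<forall>j. Polynomial.degree (Polynomial.coeff d j) < Polynomial.degree q)"
  then have "c - d = 0" by (intro zero) (auto intro: degree_diff_less)
  then show "c = d" by simp
qed

definition truncation ::
    "('a::field poly \<Rightarrow> 'g::linordered_ab_group_add extended) \<Rightarrow> 'a poly \<Rightarrow> 'a poly \<Rightarrow> 'g extended" where
  "truncation \<nu> q f =
     (let c = q_expansion q f
      in Min ((\<lambda>j. \<nu> (Polynomial.coeff c j * q ^ j)) ` {..Polynomial.degree c}))"

text \<open>The multiple \<open>j\<gamma>\<close> is a \<open>j\<close>-fold sum, so that \<open>0 \<gamma> = 0\<close> also for \<open>\<gamma> = \<infinity>\<close>.\<close>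

definition limit_augmentation ::
    "('a::field poly \<Rightarrow> 'g::linordered_ab_group_add extended) set \<Rightarrow> 'a poly \<Rightarrow> 'g extended
     \<Rightarrow> 'a poly \<Rightarrow> 'g extended" where
  "limit_augmentation \<vv> Q \<gamma> f =
     (let c = q_expansion Q f
      in Min ((\<lambda>j. eventual_value \<vv> (Polynomial.coeff c j) + (\<Sum>k<j. \<gamma>)) ` {..Polynomial.degree c}))"

text \<open>Here \<open>\<nu>'\<close> is a valuation on the polynomial ring over the algebraic closure.\<close>

definition delta ::
    "('a::field alg_closure poly \<Rightarrow> 'g::linordered_ab_group_add extended) \<Rightarrow> 'a poly \<Rightarrow> 'g extended" where
  "delta \<nu>' f =
     (if Polynomial.degree f = 0 then Minf
      else Max {\<nu>' [:- a, 1:] |a. poly (map_poly to_ac f) a = 0})"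

text \<open>
  The relation \<open>\<delta>(f) \<ge> \<delta>(Q)\<close> does not depend on the chosen extension \<open>\<nu>'\<close> of \<open>\<nu>\<close>, and
  extensions exist with values in \<open>\<Gamma> \<union> {\<infinity>}\<close>, because \<open>\<Gamma>\<close> is divisible and values of elements
  integral over \<open>K[x]\<close> lie in the divisible hull of the value group of \<open>\<nu>\<close>. The definition
  therefore quantifies over all choices of \<open>\<nu>'\<close>.
\<close>

definition is_key_polynomial ::
    "('a::field poly \<Rightarrow> 'g::divisible_linordered_ab_group_add extended) \<Rightarrow> 'a poly \<Rightarrow> bool" where
  "is_key_polynomial \<nu> Q \<longleftrightarrow>
     Polynomial.lead_coeff Q = 1 \<and>
     (\<forall>\<nu>' :: 'a alg_closure poly \<Rightarrow> 'g extended.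
        is_valuation \<nu>' \<and> (\<forall>f. \<nu>' (map_poly to_ac f) = \<nu> f) \<longrightarrow>
        (\<forall>f. f \<noteq> 0 \<and> delta \<nu>' f \<ge> delta \<nu>' Q \<longrightarrow> Polynomial.degree f \<ge> Polynomial.degree Q))"

end

theory Submission
  imports Defs
begin

text \<open>
  Write \<open>v(f)\<close> for the eventual value of a polynomial of degree smaller than \<open>Q\<close>; all of these are
  stable by the minimality of \<open>Q\<close>. The heart of the proof is that the value of \<open>Q\<close> never settles:
  every value that it takes is exceeded further up in the family. Hence a multiple \<open>Q * g\<close> cannot go on
  cancelling a polynomial \<open>r\<close> of small degree, since its value would then be constant. This yields
  \<open>\<nu>\<^sub>i(r + Q * g) \<le> v(r)\<close> for every member of the family (\<open>val_le_v_remainder\<close>), and, for \<open>a\<close> and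
  \<open>b\<close> of small degree, that the remainder of \<open>a * b\<close> modulo \<open>Q\<close> has eventual value \<open>v(a) + v(b)\<close>,
  whereas the eventual value of the quotient becomes at least \<open>v(a) + v(b)\<close> when \<open>\<gamma>\<close> is added to it
  (\<open>v_mod_mult\<close>, \<open>v_div_mult\<close>).

  The augmentation \<open>\<mu>\<close> satisfies \<open>\<mu>(r + Q * f) = min (v(r)) (\<gamma> + \<mu>(f))\<close> for \<open>r\<close> of small degree, so
  everything about it is proved by induction along the \<open>Q\<close>-expansion. The ultrametric inequality and
  \<open>\<mu>(f * g) \<ge> \<mu>(f) + \<mu>(g)\<close> follow directly. For the converse inequality, when both values are
  finite, there are two cases: if both remainders modulo \<open>Q\<close> attain the values of \<open>f\<close> and \<open>g\<close>,
  then the remainder of the product attains the sum; otherwise a remainder of too large value may be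
  discarded, and the degree drops
  (\<open>\<mu>_mult\<close>). The inequality \<open>\<nu>\<^sub>i \<le> \<mu>\<close> follows from the bound on \<open>\<nu>\<^sub>i(r + Q * g)\<close>, and it is
  strict at \<open>Q\<close>, where \<open>\<mu>\<close> has the value \<open>\<gamma>\<close>. The identity \<open>\<mu> = \<mu>\<^sub>Q\<close> holds because the terms of
  a \<open>Q\<close>-expansion are their own expansions.

  For the key polynomial property, let \<open>f \<noteq> 0\<close> have minimal degree with \<open>\<delta>(f) \<ge> \<delta>(Q)\<close>, and suppose that
  this degree is smaller than that of \<open>Q\<close>. Let \<open>a\<close> be a root of \<open>f\<close> closest to \<open>x\<close>. The remainder
  \<open>r = Q mod f\<close> satisfies \<open>r(a) = Q(a)\<close>. Evaluation at \<open>a\<close> does not lower the value of \<open>Q\<close>, no root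
  of which is closer to \<open>x\<close> than \<open>a\<close>, and does not raise that of \<open>r\<close>, all roots of which are farther
  away. So \<open>\<mu>(r) \<ge> \<mu>(Q) = \<gamma>\<close> (\<open>val_le_val_mod\<close>), and then \<open>\<mu>(f * (Q div f)) \<ge> \<gamma>\<close> as well. All
  three polynomials involved have degree smaller than \<open>Q\<close>, so far enough up in the family they have
  the same values there as for \<open>\<mu>\<close>; this forces \<open>\<nu>\<^sub>i(Q) \<ge> \<gamma>\<close>, a contradiction.
\<close>

section \<open>Valuations\<close>

lemma extended_add_strict_left_mono:
  fixes a b c :: "'g::linordered_ab_group_add extended"
  assumes "a \<noteq> Pinf" "a \<noteq> Minf" "b < c"
  shows "a + b < a + c"
  using assms by (cases a; cases b; cases c) auto

lemma extended_add_Pinf [simp]: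
  fixes a :: "'g::linordered_ab_group_add extended"
  shows "a + Pinf = Pinf" "Pinf + a = Pinf"
  by (cases a; simp)+

lemma extended_add_eq_Pinf_iff:
  fixes a b :: "'g::linordered_ab_group_add extended"
  shows "a + b = Pinf \<longleftrightarrow> a = Pinf \<or> b = Pinf"
  by (cases a; cases b) auto

lemma extended_add_eq_Minf:
  fixes a b :: "'g::linordered_ab_group_add extended"
  shows "a + b = Minf \<Longrightarrow> a = Minf \<or> b = Minf"
  by (cases a; cases b) auto

context
  fixes \<nu> :: "'r::comm_ring_1 \<Rightarrow> 'g::linordered_ab_group_add extended"
  assumes val: "is_valuation \<nu>"
begin

lemma val_not_Minf: "\<nu> a \<noteq> Minf"
  and val_mult: "\<nu> (a * b) = \<nu> a + \<nu> b"
  and val_add: "min (\<nu> a) (\<nu> b) \<le> \<nu> (a + b)"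
  and val_1: "\<nu> 1 = 0"
  and val_0: "\<nu> 0 = Pinf"
  using val by (simp_all add: is_valuation_def)

lemma val_uminus: "\<nu> (- a) = \<nu> a"
proof -
  have "\<nu> (-1) + \<nu> (-1) = 0" using val_mult[of "-1" "-1"] val_1 by simp
  then have "\<nu> (-1) = 0" by (cases "\<nu> (-1)") (auto simp: zero_extended_def)
  then show ?thesis using val_mult[of "-1" a] by simp
qed

lemma val_add_ge: "c \<le> \<nu> a \<Longrightarrow> c \<le> \<nu> b \<Longrightarrow> c \<le> \<nu> (a + b)"
  using val_add[of a b] by (meson min.boundedI order_trans)

lemma val_diff_ge: "c \<le> \<nu> a \<Longrightarrow> c \<le> \<nu> b \<Longrightarrow> c \<le> \<nu> (a - b)"
  using val_add_ge[of c a "- b"] by (simp add: val_uminus)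

lemma val_diff_eq:
  assumes "\<nu> a < \<nu> b"
  shows "\<nu> (a - b) = \<nu> a"
proof (rule antisym)
  show "\<nu> a \<le> \<nu> (a - b)" using assms by (intro val_diff_ge) auto
  show "\<nu> (a - b) \<le> \<nu> a"
    using assms val_add[of "a - b" b] by (auto simp: min_def split: if_splits)
qed

lemma val_prod_mset_mono:
  "(\<And>b. b \<in># A \<Longrightarrow> \<nu> (h b) \<le> \<nu> (k b)) \<Longrightarrow>
    \<nu> (\<Prod>b\<in>#A. h b) \<le> \<nu> (\<Prod>b\<in>#A. k b)"
  by (induction A) (simp_all add: val_mult add_mono)

end

section \<open>Values at a root over the algebraic closure\<close>

lemma map_poly_to_ac_add:
  "map_poly to_ac (p + q) = map_poly to_ac p + map_poly to_ac q"
  by (intro poly_eqI) (simp add: coeff_map_poly)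

lemma map_poly_to_ac_mult:
  "map_poly to_ac (p * q) = map_poly to_ac p * map_poly to_ac q"
  by (intro poly_eqI) (simp add: coeff_map_poly coeff_mult to_ac_sum)

text \<open>
  Passing from \<open>g\<close> to its value at \<open>a\<close> replaces each linear factor \<open>x - b\<close> by the constant \<open>a - b\<close>,
  so the comparison of \<open>g\<close> with \<open>g(a)\<close> can be made factor by factor.
\<close>

lemma
  fixes \<nu> :: "'b::alg_closed_field poly \<Rightarrow> 'g::linordered_ab_group_add extended"
  assumes \<nu>: "is_valuation \<nu>" and g: "g \<noteq> 0"
  shows val_le_val_eval:
      "(\<And>b. poly g b = 0 \<Longrightarrow> \<nu> [:- b, 1:] \<le> \<nu> [:a - b:]) \<Longrightarrow> \<nu> g \<le> \<nu> [:poly g a:]"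
    and val_eval_le_val:
      "(\<And>b. poly g b = 0 \<Longrightarrow> \<nu> [:a - b:] \<le> \<nu> [:- b, 1:]) \<Longrightarrow> \<nu> [:poly g a:] \<le> \<nu> g"
proof -
  obtain A where A: "g = Polynomial.smult (Polynomial.lead_coeff g) (\<Prod>b\<in>#A. [:- b, 1:])"
    using alg_closed_imp_factorization[OF g] by blast
  define c where "c = Polynomial.lead_coeff g"
  have g_eq: "g = [:c:] * (\<Prod>b\<in>#A. [:- b, 1:])" using A by (simp add: c_def)
  have const: "[:\<Prod>b\<in>#B. a - b:] = (\<Prod>b\<in>#B. [:a - b:])" for B :: "'b multiset"
  proof (induction B)
    case (add b B)
    have "[:\<Prod>b\<in>#add_mset b B. a - b:] = [:a - b:] * [:\<Prod>b\<in>#B. a - b:]" by simp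
    also have "\<dots> = (\<Prod>b\<in>#add_mset b B. [:a - b:])" by (simp only: add image_mset_add_mset prod_mset.add_mset)
    finally show ?case .
  qed (simp add: one_pCons)
  have "poly (\<Prod>b\<in>#B. [:- b, 1:]) a = (\<Prod>b\<in>#B. a - b)" for B :: "'b multiset"
    by (induction B) (simp_all add: algebra_simps)
  then have eval_eq: "[:poly g a:] = [:c:] * (\<Prod>b\<in>#A. [:a - b:])"
    unfolding const[symmetric] by (subst g_eq) simp
  have root: "poly g b = 0" if "b \<in># A" for b
  proof -
    have "poly (\<Prod>b\<in>#A. [:- b, 1:]) b = 0" using that by (induction A) auto
    then show ?thesis by (subst g_eq) simp
  qed
  show "\<nu> g \<le> \<nu> [:poly g a:]" if "\<And>b. poly g b = 0 \<Longrightarrow> \<nu> [:- b, 1:] \<le> \<nu> [:a - b:]"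
    unfolding eval_eq by (subst g_eq, unfold val_mult[OF \<nu>])
      (intro add_left_mono val_prod_mset_mono[OF \<nu>] that root)
  show "\<nu> [:poly g a:] \<le> \<nu> g" if "\<And>b. poly g b = 0 \<Longrightarrow> \<nu> [:a - b:] \<le> \<nu> [:- b, 1:]"
    unfolding eval_eq by (subst g_eq, unfold val_mult[OF \<nu>])
      (intro add_left_mono val_prod_mset_mono[OF \<nu>] that root)
qed

lemma delta_eq_Max:
  assumes "0 < Polynomial.degree f"
  shows "delta \<nu>' f = Max ((\<lambda>a. \<nu>' [:- a, 1:]) ` {a. poly (map_poly to_ac f) a = 0})"
  using assms by (simp add: delta_def image_Collect)

lemma finite_roots_to_ac: "f \<noteq> 0 \<Longrightarrow> finite {a. poly (map_poly to_ac f) a = 0}"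
  by (intro poly_roots_finite) (simp add: map_poly_eq_0_iff)

lemma delta_attained:
  assumes "0 < Polynomial.degree f"
  obtains a where "poly (map_poly to_ac f) a = 0" "delta \<nu>' f = \<nu>' [:- a, 1:]"
proof -
  have "0 < Polynomial.degree (map_poly to_ac f)"
    using assms by (simp add: degree_map_poly)
  then have "{a. poly (map_poly to_ac f) a = 0} \<noteq> {}"
    using alg_closed_imp_poly_has_root by blast
  moreover have "finite {a. poly (map_poly to_ac f) a = 0}"
    using assms by (intro finite_roots_to_ac) auto
  ultimately have "delta \<nu>' f \<in> (\<lambda>a. \<nu>' [:- a, 1:]) ` {a. poly (map_poly to_ac f) a = 0}"
    unfolding delta_eq_Max[OF assms] by (intro Max_in) auto
  then show ?thesis using that by auto
qed

lemma val_root_le_delta: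
  assumes "f \<noteq> 0" "poly (map_poly to_ac f) b = 0"
  shows "\<nu>' [:- b, 1:] \<le> delta \<nu>' f"
proof -
  have "0 < Polynomial.degree f"
  proof (rule ccontr)
    assume "\<not> ?thesis"
    then obtain c where "f = [:c:]" by (metis degree_eq_zeroE gr0I)
    then show False using assms by (simp add: map_poly_pCons)
  qed
  then show ?thesis
    unfolding delta_eq_Max[OF \<open>0 < _\<close>] using assms finite_roots_to_ac by (intro Max_ge) auto
qed

text \<open>
  Let \<open>a\<close> be a root of \<open>f\<close> with \<open>\<nu>'(x - a) = \<delta>(f)\<close>. The remainder \<open>r\<close> and \<open>g\<close> take the same value at
  \<open>a\<close>. All roots of \<open>r\<close> are farther from \<open>x\<close> than \<open>a\<close> is, so that evaluation at \<open>a\<close> does not raise the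
  value of \<open>r\<close>; the roots of \<open>g\<close> are at least not closer to \<open>x\<close> than \<open>a\<close>, so that evaluation at \<open>a\<close>
  does not lower the value of \<open>g\<close>.
\<close>

lemma val_le_val_mod:
  fixes \<nu>' :: "'a::field alg_closure poly \<Rightarrow> 'g::linordered_ab_group_add extended"
  assumes \<nu>': "is_valuation \<nu>'" and f: "0 < Polynomial.degree f"
    and g: "g \<noteq> 0" "delta \<nu>' g \<le> delta \<nu>' f"
    and r: "g mod f \<noteq> 0" "delta \<nu>' (g mod f) < delta \<nu>' f"
  shows "\<nu>' (map_poly to_ac g) \<le> \<nu>' (map_poly to_ac (g mod f))"
proof -
  obtain a where a: "poly (map_poly to_ac f) a = 0" "delta \<nu>' f = \<nu>' [:- a, 1:]"
    using delta_attained[OF f] .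
  have "map_poly to_ac g = map_poly to_ac (g mod f) + map_poly to_ac f * map_poly to_ac (g div f)"
    by (simp flip: map_poly_to_ac_add map_poly_to_ac_mult)
  then have eval: "poly (map_poly to_ac g) a = poly (map_poly to_ac (g mod f)) a"
    using a(1) by simp
  have "\<nu>' (map_poly to_ac g) \<le> \<nu>' [:poly (map_poly to_ac g) a:]"
  proof (rule val_le_val_eval[OF \<nu>'])
    show "map_poly to_ac g \<noteq> 0" using g(1) by (simp add: map_poly_eq_0_iff)
    fix b assume "poly (map_poly to_ac g) b = 0"
    then have "\<nu>' [:- b, 1:] \<le> \<nu>' [:- a, 1:]"
      using val_root_le_delta[OF g(1), of b \<nu>'] g(2) a(2) by simp
    then have "\<nu>' [:- b, 1:] \<le> \<nu>' ([:- b, 1:] - [:- a, 1:])"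
      by (intro val_diff_ge[OF \<nu>']) simp_all
    then show "\<nu>' [:- b, 1:] \<le> \<nu>' [:a - b:]" by simp
  qed
  also have "\<dots> = \<nu>' [:poly (map_poly to_ac (g mod f)) a:]" by (simp only: eval)
  also have "\<dots> \<le> \<nu>' (map_poly to_ac (g mod f))"
  proof (rule val_eval_le_val[OF \<nu>'])
    show "map_poly to_ac (g mod f) \<noteq> 0" using r(1) by (simp add: map_poly_eq_0_iff)
    fix b assume "poly (map_poly to_ac (g mod f)) b = 0"
    then have "\<nu>' [:- b, 1:] < \<nu>' [:- a, 1:]"
      using val_root_le_delta[OF r(1), of b \<nu>'] r(2) a(2) by simp
    then have "\<nu>' ([:- b, 1:] - [:- a, 1:]) = \<nu>' [:- b, 1:]" by (rule val_diff_eq[OF \<nu>'])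
    then show "\<nu>' [:a - b:] \<le> \<nu>' [:- b, 1:]" by simp
  qed
  finally show ?thesis .
qed

section \<open>Eventual values along a chain of valuations\<close>

text \<open>
  The filter generated by the final segments of a chain turns statements about all sufficiently
  large members into statements closed under finite conjunction.
\<close>

definition tails :: "('b::order) set \<Rightarrow> 'b filter" where
  "tails \<vv> = (INF \<nu>\<in>\<vv>. principal {\<nu>'\<in>\<vv>. \<nu> \<le> \<nu>'})"

lemma eventually_tails:
  assumes "\<vv> \<noteq> {}" and "\<And>\<nu> \<nu>'. \<nu> \<in> \<vv> \<Longrightarrow> \<nu>' \<in> \<vv> \<Longrightarrow> \<nu> \<le> \<nu>' \<or> \<nu>' \<le> \<nu>"
  shows "eventually P (tails \<vv>) \<longleftrightarrow> (\<exists>\<nu>\<in>\<vv>. \<forall>\<nu>'\<in>\<vv>. \<nu> \<le> \<nu>' \<longrightarrow> P \<nu>')"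
  unfolding tails_def
proof (subst eventually_INF_base)
  fix a b assume ab: "a \<in> \<vv>" "b \<in> \<vv>"
  show "\<exists>x\<in>\<vv>. principal {\<nu>' \<in> \<vv>. x \<le> \<nu>'} \<le>
      inf (principal {\<nu>' \<in> \<vv>. a \<le> \<nu>'}) (principal {\<nu>' \<in> \<vv>. b \<le> \<nu>'})"
  proof (cases "a \<le> b")
    case True
    then show ?thesis using ab by (intro bexI[of _ b]) auto
  next
    case False
    then have "b \<le> a" using assms(2)[OF ab] by simp
    then show ?thesis using ab by (intro bexI[of _ a]) auto
  qed
qed (use assms(1) in \<open>auto simp: eventually_principal\<close>)

text \<open>
  Minimality of \<open>Q\<close> is expressed without reference to leading coefficients: multiplication by a
  constant shifts all values of the family by the same amount and so preserves stability.
\<close>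

locale unstable_minimal =
  fixes \<nu>0 :: "'a::field \<Rightarrow> 'g::linordered_ab_group_add extended"
    and \<vv> :: "('a poly \<Rightarrow> 'g extended) set"
    and Q :: "'a poly"
    and \<gamma> :: "'g extended"
  assumes nonempty: "\<vv> \<noteq> {}"
    and ext: "\<vv> \<subseteq> extensions \<nu>0"
    and chain: "\<And>\<nu> \<nu>'. \<nu> \<in> \<vv> \<Longrightarrow> \<nu>' \<in> \<vv> \<Longrightarrow> \<nu> \<le> \<nu>' \<or> \<nu>' \<le> \<nu>"
    and unstable: "\<not> eventually_stable \<vv> Q"
    and small_stable: "\<And>f. Polynomial.degree f < Polynomial.degree Q \<Longrightarrow> eventually_stable \<vv> f"
    and bound: "\<And>\<nu>. \<nu> \<in> \<vv> \<Longrightarrow> \<nu> Q < \<gamma>"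
begin

abbreviation small :: "'a poly \<Rightarrow> bool" where
  "small f \<equiv> Polynomial.degree f < Polynomial.degree Q"

abbreviation v :: "'a poly \<Rightarrow> 'g extended" where
  "v \<equiv> eventual_value \<vv>"

abbreviation \<mu> :: "'a poly \<Rightarrow> 'g extended" where
  "\<mu> \<equiv> limit_augmentation \<vv> Q \<gamma>"

lemma valuation: "\<nu> \<in> \<vv> \<Longrightarrow> is_valuation \<nu>"
  and val_const: "\<nu> \<in> \<vv> \<Longrightarrow> \<nu> [:a:] = \<nu>0 a"
  using ext by (auto simp: extensions_def)

lemma degree_Q_pos: "0 < Polynomial.degree Q"
proof (rule ccontr)
  assume "\<not> ?thesis"
  then obtain c where c: "Q = [:c:]" by (metis degree_eq_zeroE gr0I)
  obtain \<nu> where \<nu>: "\<nu> \<in> \<vv>" using nonempty by blast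
  have "\<forall>\<nu>'\<in>\<vv>. \<nu> \<le> \<nu>' \<longrightarrow> \<nu>' Q = \<nu> Q" unfolding c using val_const \<nu> by metis
  then show False using unstable \<nu> unfolding eventually_stable_def by blast
qed

lemma Q_nonzero: "Q \<noteq> 0"
  using degree_Q_pos by auto

lemma small_0: "small 0"
  using degree_Q_pos by simp

lemma small_mod: "small (f mod Q)"
  using degree_mod_less[OF Q_nonzero, of f] degree_Q_pos by auto

lemma eventually_v_iff:
  "eventually P (tails \<vv>) \<longleftrightarrow> (\<exists>\<nu>\<in>\<vv>. \<forall>\<nu>'\<in>\<vv>. \<nu> \<le> \<nu>' \<longrightarrow> P \<nu>')"
  by (rule eventually_tails) (use nonempty chain in auto)

lemma tails_nontrivial: "tails \<vv> \<noteq> bot"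
  using nonempty by (auto simp: trivial_limit_def eventually_v_iff)

lemma eventually_mem: "eventually (\<lambda>\<nu>. \<nu> \<in> \<vv>) (tails \<vv>)"
  using nonempty by (auto simp: eventually_v_iff)

lemma eventually_above: "\<nu> \<in> \<vv> \<Longrightarrow> eventually (\<lambda>\<nu>'. \<nu> \<le> \<nu>') (tails \<vv>)"
  by (auto simp: eventually_v_iff)

lemma eventually_v:
  assumes "small f"
  shows "eventually (\<lambda>\<nu>. \<nu> f = v f) (tails \<vv>)"
proof -
  obtain \<nu>f where \<nu>f: "\<nu>f \<in> \<vv>" "\<forall>\<nu>\<in>\<vv>. \<nu>f \<le> \<nu> \<longrightarrow> \<nu> f = \<nu>f f"
    using small_stable[OF assms] by (auto simp: eventually_stable_def)
  have eq: "v f = \<nu>f f" using chain by (intro eventual_value_eq[OF _ \<nu>f]) blast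
  show ?thesis unfolding eventually_v_iff eq by (rule bexI[of _ \<nu>f]) (fact \<nu>f)+
qed

lemma v_const: "v [:a:] = \<nu>0 a"
proof -
  have "small [:a:]" using degree_Q_pos by simp
  have "eventually (\<lambda>\<nu>. v [:a:] = \<nu>0 a) (tails \<vv>)"
    using eventually_v[OF \<open>small [:a:]\<close>] eventually_mem
    by eventually_elim (metis val_const)
  then show ?thesis by (simp add: tails_nontrivial)
qed

lemma v_0: "v 0 = Pinf"
  using v_const[of 0] nonempty val_0[OF valuation] val_const by (metis all_not_in_conv pCons_0_0)

lemma v_1: "v 1 = 0"
  using v_const[of 1] nonempty val_1[OF valuation] val_const by (metis all_not_in_conv one_pCons)

lemma v_not_Minf: "small f \<Longrightarrow> v f \<noteq> Minf"
proof -
  assume f: "small f"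
  have "eventually (\<lambda>\<nu>. v f \<noteq> Minf) (tails \<vv>)"
    using eventually_v[OF f] eventually_mem
    by eventually_elim (metis val_not_Minf valuation)
  then show ?thesis by (simp add: tails_nontrivial)
qed

lemma v_add:
  assumes "small f" "small g"
  shows "min (v f) (v g) \<le> v (f + g)"
proof -
  have fg: "small (f + g)" using assms by (rule degree_add_less)
  have "eventually (\<lambda>\<nu>. min (v f) (v g) \<le> v (f + g)) (tails \<vv>)"
    using eventually_v[OF assms(1)] eventually_v[OF assms(2)] eventually_v[OF fg] eventually_mem
    by eventually_elim (metis val_add valuation)
  then show ?thesis by (simp add: tails_nontrivial)
qed

lemma v_uminus:
  assumes "small f"
  shows "v (- f) = v f"
proof -
  have nf: "small (- f)" using assms by simp
  have "eventually (\<lambda>\<nu>. v (- f) = v f) (tails \<vv>)"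
    using eventually_v[OF assms] eventually_v[OF nf] eventually_mem
    by eventually_elim (metis val_uminus valuation)
  then show ?thesis by (simp add: tails_nontrivial)
qed

lemma \<gamma>_not_Minf: "\<gamma> \<noteq> Minf"
  using nonempty bound by force

lemma Q_increases:
  assumes "\<nu> \<in> \<vv>"
  obtains \<nu>' where "\<nu>' \<in> \<vv>" "\<nu> \<le> \<nu>'" "\<nu> Q < \<nu>' Q"
proof -
  obtain \<nu>' where "\<nu>' \<in> \<vv>" "\<nu> \<le> \<nu>'" "\<nu>' Q \<noteq> \<nu> Q"
    using unstable assms by (auto simp: eventually_stable_def)
  then show ?thesis using that by (metis le_funD order_le_less)
qed

text \<open>
  If \<open>\<nu> (r + Q * g)\<close> exceeded the eventual value of \<open>r\<close>, then from some point on \<open>Q * g\<close> would have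
  to cancel the value of \<open>r\<close>, and so would have constant finite value. That is impossible, because
  the value of \<open>Q\<close> keeps growing and that of \<open>g\<close> does not decrease.
\<close>

lemma val_le_v_remainder:
  assumes "\<nu> \<in> \<vv>" "small r"
  shows "\<nu> (r + Q * g) \<le> v r"
proof (rule ccontr)
  assume "\<not> ?thesis"
  then have less: "v r < \<nu> (r + Q * g)" by simp
  have "eventually (\<lambda>\<nu>'. \<nu>' \<in> \<vv> \<and> \<nu>' (Q * g) = v r) (tails \<vv>)"
    using eventually_v[OF assms(2)] eventually_above[OF assms(1)] eventually_mem
  proof eventually_elim
    case (elim \<nu>')
    have "\<nu>' r < \<nu>' (r + Q * g)" using elim less by (metis le_funD order_less_le_trans)
    then have "\<nu>' (r - (r + Q * g)) = v r"
      using val_diff_eq[OF valuation] elim by metis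
    moreover have "r - (r + Q * g) = - (Q * g)" by simp
    ultimately show ?case using elim val_uminus[OF valuation] by metis
  qed
  then obtain \<nu>1 where \<nu>1: "\<nu>1 \<in> \<vv>"
    "\<And>\<nu>'. \<nu>' \<in> \<vv> \<Longrightarrow> \<nu>1 \<le> \<nu>' \<Longrightarrow> \<nu>' (Q * g) = v r"
    by (auto simp: eventually_v_iff)
  obtain \<nu>2 where \<nu>2: "\<nu>2 \<in> \<vv>" "\<nu>1 \<le> \<nu>2" "\<nu>1 Q < \<nu>2 Q"
    using Q_increases[OF \<nu>1(1)] .
  have 1: "v r = \<nu>1 g + \<nu>1 Q" and 2: "v r = \<nu>2 g + \<nu>2 Q"
    using \<nu>1(2)[of \<nu>1] \<nu>1(2)[of \<nu>2] \<nu>1(1) \<nu>2 val_mult[OF valuation]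
    by (simp_all add: add.commute)
  have "v r \<noteq> Pinf" using less by auto
  then have "\<nu>1 g \<noteq> Pinf" using 1 by (auto simp: extended_add_eq_Pinf_iff)
  then have "\<nu>1 g + \<nu>1 Q < \<nu>1 g + \<nu>2 Q"
    using \<nu>2 val_not_Minf[OF valuation[OF \<nu>1(1)]] by (intro extended_add_strict_left_mono) auto
  also have "\<dots> \<le> \<nu>2 g + \<nu>2 Q" using \<nu>2 by (intro add_right_mono) (auto simp: le_fun_def)
  finally show False using 1 2 by simp
qed

text \<open>
  Write \<open>a * b = r + Q * q\<close>. The values of \<open>a * b\<close>, \<open>r\<close> and \<open>q\<close> are eventually constant while that
  of \<open>Q\<close> keeps growing. Were the constants of \<open>a * b\<close> and \<open>r\<close> different, the value of \<open>Q * q\<close> would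
  be their minimum, a finite constant, which is absurd; so the remainder carries the whole value of
  the product. Consequently \<open>Q * q = a * b - r\<close> has at least this value, and \<open>\<gamma>\<close> exceeds the value
  of \<open>Q\<close>.
\<close>

lemma
  assumes "small a" "small b"
  shows small_div_mult: "small ((a * b) div Q)"
    and v_mod_mult: "v ((a * b) mod Q) = v a + v b"
    and v_div_mult: "v a + v b \<le> \<gamma> + v ((a * b) div Q)"
proof -
  define r q where "r = (a * b) mod Q" and "q = (a * b) div Q"
  have ab: "a * b = r + Q * q" by (simp add: r_def q_def)
  have r: "small r" by (simp add: r_def small_mod)
  have q: "small q"
  proof (rule ccontr)
    assume not: "\<not> ?thesis"
    then have "q \<noteq> 0" using small_0 by auto
    then have "Polynomial.degree Q + Polynomial.degree q = Polynomial.degree (Q * q)"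
      by (simp add: degree_mult_eq Q_nonzero)
    also have "Q * q = a * b - r" using ab by simp
    also have "Polynomial.degree (a * b - r) < Polynomial.degree Q + Polynomial.degree Q"
      using degree_mult_le[of a b] assms r by (intro degree_diff_less) auto
    finally show False using not by simp
  qed
  then show "small ((a * b) div Q)" by (simp add: q_def)
  have "eventually (\<lambda>\<nu>. \<nu> \<in> \<vv> \<and> \<nu> (a * b) = v a + v b \<and> \<nu> r = v r \<and> \<nu> q = v q) (tails \<vv>)"
    using eventually_v[OF assms(1)] eventually_v[OF assms(2)] eventually_v[OF r]
      eventually_v[OF q] eventually_mem
    by eventually_elim (metis val_mult valuation)
  then obtain \<nu>1 where \<nu>1: "\<nu>1 \<in> \<vv>"
    "\<And>\<nu>. \<nu> \<in> \<vv> \<Longrightarrow> \<nu>1 \<le> \<nu> \<Longrightarrow> \<nu> (a * b) = v a + v b \<and> \<nu> r = v r \<and> \<nu> q = v q"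
    by (auto simp: eventually_v_iff)
  have le: "v a + v b \<le> v r"
    using val_le_v_remainder[OF \<nu>1(1) r, of q] \<nu>1(2)[of \<nu>1] \<nu>1(1) ab by simp
  have Qq: "Q * q = a * b - r" using ab by simp
  have "v a + v b \<le> \<nu>1 (Q * q)"
    unfolding Qq using \<nu>1(2)[OF \<nu>1(1)] le by (intro val_diff_ge[OF valuation[OF \<nu>1(1)]]) simp_all
  also have "\<nu>1 (Q * q) = \<nu>1 Q + v q"
    using \<nu>1(2)[OF \<nu>1(1)] val_mult[OF valuation[OF \<nu>1(1)], of Q q] by simp
  also have "\<dots> \<le> \<gamma> + v q" using bound[OF \<nu>1(1)] by (intro add_right_mono) simp
  finally show "v a + v b \<le> \<gamma> + v ((a * b) div Q)" by (simp add: q_def)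
  have "\<not> v a + v b < v r"
  proof
    assume less: "v a + v b < v r"
    have eq: "v q + \<nu> Q = v a + v b" if "\<nu> \<in> \<vv>" "\<nu>1 \<le> \<nu>" for \<nu>
    proof -
      have "\<nu> (Q * q) = v a + v b"
        unfolding Qq using val_diff_eq[OF valuation[OF that(1)], of "a * b" r] \<nu>1(2)[OF that] less
        by simp
      then show ?thesis
        using val_mult[OF valuation[OF that(1)]] \<nu>1(2)[OF that] by (simp add: add.commute)
    qed
    obtain \<nu>2 where \<nu>2: "\<nu>2 \<in> \<vv>" "\<nu>1 \<le> \<nu>2" "\<nu>1 Q < \<nu>2 Q"
      using Q_increases[OF \<nu>1(1)] .
    have "v q \<noteq> Pinf"
      using eq[OF \<nu>2(1,2)] less by (auto simp: extended_add_eq_Pinf_iff)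
    then have "v q + \<nu>1 Q < v q + \<nu>2 Q"
      using \<nu>2 v_not_Minf[OF q] by (intro extended_add_strict_left_mono) auto
    then show False using eq[OF \<nu>1(1)] eq[OF \<nu>2(1,2)] by simp
  qed
  then show "v ((a * b) mod Q) = v a + v b" using le by (simp add: r_def)
qed

section \<open>The augmentation as a recursion on the Q-expansion\<close>

lemma q_expansion_step:
  assumes "small r"
  shows "q_expansion Q (r + Q * f) = pCons r (q_expansion Q f)"
proof -
  have spec: "poly (q_expansion Q f) Q = f \<and>
      (\<forall>j. Polynomial.degree (Polynomial.coeff (q_expansion Q f) j) < Polynomial.degree Q)"
    unfolding q_expansion_def by (rule theI'[OF q_expansion_ex1[OF degree_Q_pos]])
  show ?thesis
    unfolding q_expansion_def[of Q "r + Q * f"]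
    by (rule the1_equality[OF q_expansion_ex1[OF degree_Q_pos]])
      (use spec assms in \<open>auto simp: coeff_pCons split: nat.splits\<close>)
qed

lemma q_expansion_0: "q_expansion Q 0 = 0"
  unfolding q_expansion_def
  by (rule the1_equality[OF q_expansion_ex1[OF degree_Q_pos]]) (simp add: degree_Q_pos)

lemma small_coeff_q_expansion: "small (Polynomial.coeff (q_expansion Q f) j)"
  using theI'[OF q_expansion_ex1[OF degree_Q_pos, of f]] by (simp add: q_expansion_def)

lemma expansion_induct [case_names 0 step]:
  assumes "P 0" and "\<And>r f. small r \<Longrightarrow> P f \<Longrightarrow> P (r + Q * f)"
  shows "P f"
proof (induction "Polynomial.degree f" arbitrary: f rule: less_induct)
  case less
  have "P (f div Q)"
  proof (cases "small f")
    case True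
    then show ?thesis using assms(1) by (simp add: div_poly_less)
  next
    case False
    then show ?thesis using degree_Q_pos by (intro less degree_div_less) auto
  qed
  then show ?case using assms(2)[OF small_mod, of "f div Q" f] by simp
qed

lemma \<mu>_0: "\<mu> 0 = Pinf"
  by (simp add: limit_augmentation_def q_expansion_0 v_0)

lemma \<mu>_step:
  assumes "small r"
  shows "\<mu> (r + Q * f) = min (v r) (\<gamma> + \<mu> f)"
proof -
  define c where "c = q_expansion Q f"
  define t where "t = (\<lambda>j. v (Polynomial.coeff c j) + (\<Sum>k<j. \<gamma>))"
  have f: "\<mu> f = Min (t ` {..Polynomial.degree c})"
    by (simp add: limit_augmentation_def c_def t_def Let_def)
  have eq: "\<mu> (r + Q * f) = Min ((\<lambda>j. v (Polynomial.coeff (pCons r c) j) + (\<Sum>k<j. \<gamma>)) `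
      {..Polynomial.degree (pCons r c)})"
    by (simp add: limit_augmentation_def q_expansion_step[OF assms] c_def Let_def)
  show ?thesis
  proof (cases "c = 0")
    case True
    then show ?thesis unfolding eq f by (simp add: t_def v_0)
  next
    case False
    have "\<mu> (r + Q * f) = Min (insert (v r) ((\<lambda>x. \<gamma> + x) ` t ` {..Polynomial.degree c}))"
      unfolding eq using False
      by (simp add: atMost_Suc_eq_insert_0 image_image t_def lessThan_Suc add.left_commute del: sum_constant)
    also have "\<dots> = min (v r) (Min ((\<lambda>x. \<gamma> + x) ` t ` {..Polynomial.degree c}))"
      by (subst Min_insert) auto
    also have "Min ((\<lambda>x. \<gamma> + x) ` t ` {..Polynomial.degree c}) = \<gamma> + \<mu> f"
      unfolding f by (rule mono_Min_commute[symmetric]) (auto intro!: monoI add_left_mono)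
    finally show ?thesis .
  qed
qed

lemma \<mu>_mod_div: "\<mu> f = min (v (f mod Q)) (\<gamma> + \<mu> (f div Q))"
  using \<mu>_step[OF small_mod, of f "f div Q"] by simp

lemma \<mu>_small: "small r \<Longrightarrow> \<mu> r = v r"
  using \<mu>_step[of r 0] by (simp add: \<mu>_0)

lemma \<mu>_Q_mult: "\<mu> (Q * f) = \<gamma> + \<mu> f"
  using \<mu>_step[OF small_0, of f] by (simp add: v_0)

lemma \<mu>_Q: "\<mu> Q = \<gamma>"
  using \<mu>_Q_mult[of 1] degree_Q_pos by (simp add: \<mu>_small v_1)

lemma \<mu>_not_Minf: "\<mu> f \<noteq> Minf"
proof (induction f rule: expansion_induct)
  case (step r f)
  then show ?case
    using \<gamma>_not_Minf v_not_Minf[of r] extended_add_eq_Minf[of \<gamma> "\<mu> f"]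
    by (auto simp: \<mu>_step min_def)
qed (simp add: \<mu>_0)

section \<open>The augmentation is a valuation\<close>

lemma \<mu>_add: "min (\<mu> f) (\<mu> g) \<le> \<mu> (f + g)"
proof (induction f arbitrary: g rule: expansion_induct)
  case (step r f)
  define s h where "s = g mod Q" and "h = g div Q"
  have s: "small s" and g: "g = s + Q * h" by (simp_all add: s_def h_def small_mod)
  have rs: "small (r + s)" using step(1) s by (rule degree_add_less)
  have "min (min (v r) (\<gamma> + \<mu> f)) (min (v s) (\<gamma> + \<mu> h)) \<le> min (v (r + s)) (\<gamma> + \<mu> (f + h))"
  proof (rule min.boundedI)
    show "min (min (v r) (\<gamma> + \<mu> f)) (min (v s) (\<gamma> + \<mu> h)) \<le> v (r + s)"
      using v_add[OF step(1) s] by (auto simp: min_def split: if_splits)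
    have "min (\<gamma> + \<mu> f) (\<gamma> + \<mu> h) = \<gamma> + min (\<mu> f) (\<mu> h)"
      by (metis add_left_mono linear min.absorb1 min.absorb2)
    also have "\<dots> \<le> \<gamma> + \<mu> (f + h)" using step(2) by (rule add_left_mono)
    finally show "min (min (v r) (\<gamma> + \<mu> f)) (min (v s) (\<gamma> + \<mu> h)) \<le> \<gamma> + \<mu> (f + h)"
      by (auto simp: min_def split: if_splits)
  qed
  moreover have "r + Q * f + g = (r + s) + Q * (f + h)" by (simp add: g algebra_simps)
  ultimately show ?case by (simp only: g \<mu>_step[OF step(1)] \<mu>_step[OF s] \<mu>_step[OF rs])
qed (simp add: \<mu>_0)

lemma \<mu>_add_ge: "c \<le> \<mu> f \<Longrightarrow> c \<le> \<mu> g \<Longrightarrow> c \<le> \<mu> (f + g)"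
  using \<mu>_add[of f g] by (meson min.boundedI order_trans)

lemma \<mu>_small_mult_ge:
  assumes a: "small a"
  shows "v a + \<mu> g \<le> \<mu> (a * g)"
proof (induction g rule: expansion_induct)
  case (step s g)
  have "v a + \<mu> (s + Q * g) \<le> v a + v s"
    using step by (intro add_left_mono) (simp add: \<mu>_step)
  also have "\<dots> \<le> \<mu> (a * s)"
    using v_mod_mult[OF a step(1)] v_div_mult[OF a step(1)] small_div_mult[OF a step(1)]
    by (subst \<mu>_mod_div) (simp add: \<mu>_small)
  finally have 1: "v a + \<mu> (s + Q * g) \<le> \<mu> (a * s)" .
  have "v a + \<mu> (s + Q * g) \<le> v a + (\<gamma> + \<mu> g)"
    using step by (intro add_left_mono) (simp add: \<mu>_step)
  also have "\<dots> \<le> \<gamma> + \<mu> (a * g)"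
    using add_left_mono[OF step(2), of \<gamma>] by (simp add: ac_simps)
  finally have 2: "v a + \<mu> (s + Q * g) \<le> \<mu> (Q * (a * g))" by (simp add: \<mu>_Q_mult)
  show ?case using \<mu>_add_ge[OF 1 2] by (simp add: algebra_simps)
qed (simp add: \<mu>_0)

lemma \<mu>_mult_ge: "\<mu> f + \<mu> g \<le> \<mu> (f * g)"
proof (induction f rule: expansion_induct)
  case (step r f)
  have "\<mu> (r + Q * f) + \<mu> g \<le> v r + \<mu> g"
    using step by (intro add_right_mono) (simp add: \<mu>_step)
  also have "\<dots> \<le> \<mu> (r * g)" using step(1) by (rule \<mu>_small_mult_ge)
  finally have 1: "\<mu> (r + Q * f) + \<mu> g \<le> \<mu> (r * g)" .
  have "\<mu> (r + Q * f) + \<mu> g \<le> (\<gamma> + \<mu> f) + \<mu> g"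
    using step by (intro add_right_mono) (simp add: \<mu>_step)
  also have "\<dots> \<le> \<gamma> + \<mu> (f * g)"
    using add_left_mono[OF step(2), of \<gamma>] by (simp add: ac_simps)
  finally have 2: "\<mu> (r + Q * f) + \<mu> g \<le> \<mu> (Q * (f * g))" by (simp add: \<mu>_Q_mult)
  show ?case using \<mu>_add_ge[OF 1 2] by (simp add: algebra_simps)
qed (simp add: \<mu>_0)

text \<open>
  A remainder of value larger than \<open>\<mu> (r + Q * f)\<close> contributes only terms of too large value to a
  product, so the product has the value of its part divisible by \<open>Q\<close>.
\<close>

lemma \<mu>_mult_discard_remainder:
  assumes r: "small r" and less: "\<mu> (r + Q * f) < v r" and fin: "\<mu> g \<noteq> Pinf"
    and IH: "\<mu> (f * g) = \<mu> f + \<mu> g"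
  shows "\<mu> ((r + Q * f) * g) = \<mu> (r + Q * f) + \<mu> g"
proof (rule ccontr)
  assume neq: "\<not> ?thesis"
  have F: "\<mu> (r + Q * f) = \<gamma> + \<mu> f" using less by (auto simp: \<mu>_step[OF r] min_def split: if_splits)
  define s where "s = \<mu> (r + Q * f) + \<mu> g"
  have "s < \<mu> ((r + Q * f) * g)"
    using neq \<mu>_mult_ge[of "r + Q * f" g] by (simp add: s_def)
  moreover have "s < \<mu> (- r * g)"
  proof -
    have "s < \<mu> g + v r"
      using extended_add_strict_left_mono[OF fin \<mu>_not_Minf less] by (simp add: s_def add.commute)
    also have "\<dots> = v (- r) + \<mu> g" by (simp add: v_uminus[OF r] add.commute)
    also have "\<dots> \<le> \<mu> (- r * g)" using r by (intro \<mu>_small_mult_ge) simp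
    finally show ?thesis .
  qed
  ultimately have "s < min (\<mu> ((r + Q * f) * g)) (\<mu> (- r * g))" by simp
  also have "\<dots> \<le> \<mu> ((r + Q * f) * g + - r * g)" by (rule \<mu>_add)
  also have "(r + Q * f) * g + - r * g = Q * (f * g)" by (simp add: algebra_simps)
  also have "\<mu> \<dots> = s" by (simp add: \<mu>_Q_mult IH s_def F ac_simps)
  finally show False by simp
qed

text \<open>
  When the remainders of both factors carry their values, so does the remainder of the product;
  otherwise one remainder can be discarded, which lowers the degree.
\<close>

lemma \<mu>_mult: "\<mu> (f * g) = \<mu> f + \<mu> g"
proof (induction f arbitrary: g rule: expansion_induct)
  case (step r f)
  note r = step(1) and IHf = step(2)
  show ?case
  proof (induction g rule: expansion_induct)
    case (step s g)
    let ?F = "r + Q * f" and ?G = "s + Q * g"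
    have F: "\<mu> ?F \<le> v r" and G: "\<mu> ?G \<le> v s" using r step(1) by (simp_all add: \<mu>_step)
    consider "\<mu> ?F = Pinf \<or> \<mu> ?G = Pinf"
      | "\<mu> ?F = v r" "\<mu> ?G = v s"
      | "\<mu> ?F < v r" "\<mu> ?G \<noteq> Pinf"
      | "\<mu> ?G < v s" "\<mu> ?F \<noteq> Pinf"
      using F G by force
    then show ?case
    proof cases
      case 1
      then have "\<mu> ?F + \<mu> ?G = Pinf" by (simp add: extended_add_eq_Pinf_iff)
      then show ?thesis using \<mu>_mult_ge[of ?F ?G] by simp
    next
      case 2
      have "\<mu> (?F * ?G) \<le> v ((?F * ?G) mod Q)" by (subst \<mu>_mod_div) simp
      also have "(?F * ?G) mod Q = (r * s) mod Q"
        by (metis mod_mult_eq mod_mult_self2)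
      also have "v \<dots> = \<mu> ?F + \<mu> ?G" using v_mod_mult[OF r step(1)] 2 by simp
      finally show ?thesis using \<mu>_mult_ge[of ?F ?G] by simp
    next
      case 3
      then show ?thesis using IHf by (intro \<mu>_mult_discard_remainder r) auto
    next
      case 4
      then have "\<mu> (?G * ?F) = \<mu> ?G + \<mu> ?F"
        using step by (intro \<mu>_mult_discard_remainder) (auto simp: mult.commute add.commute)
      then show ?thesis by (simp add: mult.commute add.commute)
    qed
  qed (simp add: \<mu>_0)
qed (simp add: \<mu>_0)

lemma \<mu>_valuation: "is_valuation \<mu>"
  using degree_Q_pos
  by (simp add: is_valuation_def \<mu>_not_Minf \<mu>_mult \<mu>_add \<mu>_0 \<mu>_small v_1)

lemma \<mu>_extends: "\<mu> \<in> extensions \<nu>0"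
  using degree_Q_pos by (simp add: extensions_def \<mu>_valuation \<mu>_small v_const)

section \<open>Comparison with the family, and truncation\<close>

text \<open>
  The bound \<open>\<nu> (r + Q * f) \<le> v r\<close> is what makes this work: \<open>r\<close> eventually has a value not below
  that of \<open>r + Q * f\<close> at \<open>\<nu>\<close>, hence so has \<open>Q * f\<close>, and the induction hypothesis applies to \<open>f\<close>.
  It is needed at a later member of the family than \<open>\<nu>\<close>, whence the generalization over \<open>\<nu>\<close>.
\<close>

lemma le_\<mu>: "\<nu> \<in> \<vv> \<Longrightarrow> \<nu> f \<le> \<mu> f"
proof (induction f arbitrary: \<nu> rule: expansion_induct)
  case (step r f)
  let ?F = "r + Q * f"
  have le: "\<nu> ?F \<le> v r" using step(3,1) by (rule val_le_v_remainder)
  have "eventually (\<lambda>\<nu>'. \<nu>' \<in> \<vv> \<and> \<nu> \<le> \<nu>' \<and> \<nu>' r = v r) (tails \<vv>)"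
    using eventually_v[OF step(1)] eventually_above[OF step(3)] eventually_mem
    by eventually_elim simp
  then obtain \<nu>' where \<nu>': "\<nu>' \<in> \<vv>" "\<nu> \<le> \<nu>'" "\<nu>' r = v r"
    using eventually_happens'[OF tails_nontrivial] by blast
  have "\<nu> ?F \<le> \<nu>' (?F - r)"
    using \<nu>'(3) le le_funD[OF \<nu>'(2)] by (intro val_diff_ge[OF valuation[OF \<nu>'(1)]]) simp_all
  also have "\<dots> = \<nu>' Q + \<nu>' f" using val_mult[OF valuation[OF \<nu>'(1)]] by simp
  also have "\<dots> \<le> \<gamma> + \<mu> f" using bound[OF \<nu>'(1)] step(2)[OF \<nu>'(1)] by (intro add_mono) auto
  finally show ?case using le by (simp add: \<mu>_step[OF step(1)])
qed (simp add: \<mu>_0)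

lemma less_\<mu>:
  assumes "\<nu> \<in> \<vv>"
  shows "\<nu> < \<mu>"
  using le_\<mu>[OF assms] bound[OF assms] \<mu>_Q by (metis le_fun_def less_fun_def not_le)

lemma \<mu>_mult_Q_power: "\<mu> (f * Q ^ j) = \<mu> f + (\<Sum>k<j. \<gamma>)"
  by (induction j) (simp_all add: \<mu>_mult \<mu>_Q ac_simps del: sum_constant)

lemma truncation_\<mu>: "truncation \<mu> Q = \<mu>"
proof
  fix f
  have "truncation \<mu> Q f =
      Min ((\<lambda>j. v (Polynomial.coeff (q_expansion Q f) j) + (\<Sum>k<j. \<gamma>)) `
        {..Polynomial.degree (q_expansion Q f)})"
    by (simp only: truncation_def Let_def \<mu>_mult_Q_power \<mu>_small[OF small_coeff_q_expansion])
  then show "truncation \<mu> Q f = \<mu> f" by (simp only: limit_augmentation_def Let_def)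
qed

section \<open>The minimal unstable polynomial is a key polynomial\<close>

text \<open>
  Let \<open>f\<close> have minimal degree among the nonzero polynomials with \<open>\<delta>(f) \<ge> \<delta>(Q)\<close>, and suppose
  that this degree is smaller than that of \<open>Q\<close>. If \<open>Q mod f\<close> is nonzero, minimality makes
  \<open>\<delta>(Q mod f)\<close> smaller than \<open>\<delta>(f)\<close>. So in any case \<open>\<mu>(Q mod f) \<ge> \<mu>(Q) = \<gamma>\<close>, and hence also
  \<open>\<mu>(f * (Q div f)) \<ge> \<gamma>\<close>. On the polynomials \<open>Q mod f\<close>, \<open>f\<close> and \<open>Q div f\<close>, all of degree smaller
  than \<open>Q\<close>, eventually every member of the family agrees with \<open>\<mu>\<close>, so it gives \<open>Q\<close> at least the
  value \<open>\<gamma>\<close>, which is excluded.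
\<close>

lemma degree_ge_if_delta_ge:
  fixes \<nu>' :: "'a alg_closure poly \<Rightarrow> 'g extended"
  assumes \<nu>': "is_valuation \<nu>'" and \<nu>'_ext: "\<And>f. \<nu>' (map_poly to_ac f) = \<mu> f"
    and f0: "f0 \<noteq> 0" "delta \<nu>' Q \<le> delta \<nu>' f0"
  shows "Polynomial.degree Q \<le> Polynomial.degree f0"
proof (rule ccontr)
  assume "\<not> ?thesis"
  then have f0_small: "small f0" by simp
  obtain f where f: "f \<noteq> 0" "delta \<nu>' Q \<le> delta \<nu>' f"
    and min: "\<And>g. g \<noteq> 0 \<Longrightarrow> delta \<nu>' Q \<le> delta \<nu>' g \<Longrightarrow> Polynomial.degree f \<le> Polynomial.degree g"
    using ex_has_least_nat[of "\<lambda>f. f \<noteq> 0 \<and> delta \<nu>' Q \<le> delta \<nu>' f" f0 Polynomial.degree] f0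
    by blast
  have small_f: "small f" using min[OF f0] f0_small by simp
  obtain b where "delta \<nu>' Q = \<nu>' [:- b, 1:]"
    using delta_attained[OF degree_Q_pos] by metis
  then have "delta \<nu>' f \<noteq> Minf" using f(2) val_not_Minf[OF \<nu>'] by auto
  then have deg_f: "0 < Polynomial.degree f"
    by (auto simp: delta_def split: if_splits)
  define r h where "r = Q mod f" and "h = Q div f"
  have Q: "Q = r + f * h" by (simp add: r_def h_def)
  have deg_r: "Polynomial.degree r < Polynomial.degree f"
    using degree_mod_less[OF f(1), of Q] deg_f by (auto simp: r_def)
  then have small_r: "small r" using small_f by simp
  have small_h: "small h"
    unfolding h_def using deg_f small_f by (intro degree_div_less) auto
  have "\<gamma> \<le> \<mu> r"
  proof (cases "r = 0")
    case False
    then have "delta \<nu>' r < delta \<nu>' Q" using min[of r] deg_r by force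
    then have "\<nu>' (map_poly to_ac Q) \<le> \<nu>' (map_poly to_ac (Q mod f))"
      using False f(2) unfolding r_def by (intro val_le_val_mod[OF \<nu>' deg_f Q_nonzero]) simp_all
    then show ?thesis by (simp add: \<nu>'_ext \<mu>_Q r_def)
  qed (simp add: \<mu>_0)
  moreover have "\<gamma> \<le> \<mu> f + \<mu> h"
  proof -
    have "\<gamma> \<le> \<mu> (Q - r)"
      using \<open>\<gamma> \<le> \<mu> r\<close> by (intro val_diff_ge[OF \<mu>_valuation]) (simp_all add: \<mu>_Q)
    also have "Q - r = f * h" by (metis Q add_diff_cancel_left')
    finally show ?thesis by (simp only: \<mu>_mult)
  qed
  ultimately have le: "\<gamma> \<le> v r" "\<gamma> \<le> v f + v h" using small_f small_r small_h by (simp_all add: \<mu>_small)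
  have "eventually (\<lambda>\<nu>. \<gamma> \<le> \<nu> Q \<and> \<nu> \<in> \<vv>) (tails \<vv>)"
    using eventually_v[OF small_r] eventually_v[OF small_f] eventually_v[OF small_h] eventually_mem
  proof eventually_elim
    case (elim \<nu>)
    have "\<gamma> \<le> \<nu> (f * h)" using le elim val_mult[OF valuation[OF elim(4)]] by metis
    then have "\<gamma> \<le> \<nu> (r + f * h)"
      using le elim by (intro val_add_ge[OF valuation[OF elim(4)]]) simp_all
    then show ?case using elim by (simp flip: Q)
  qed
  then obtain \<nu> where "\<gamma> \<le> \<nu> Q" "\<nu> \<in> \<vv>"
    using eventually_happens'[OF tails_nontrivial] by blast
  then show False using bound by force
qed

end

theorem proposition4p12:
  fixes \<nu>0 :: "'a::field \<Rightarrow> 'g::divisible_linordered_ab_group_add extended"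
    and \<vv> :: "('a poly \<Rightarrow> 'g extended) set"
    and Q :: "'a poly"
    and \<gamma> :: "'g extended"
  assumes "is_valuation \<nu>0" and "\<forall>a. \<nu>0 a = Pinf \<longrightarrow> a = 0"
    and "\<vv> \<noteq> {}" and "\<vv> \<subseteq> extensions \<nu>0"
    and "\<forall>\<nu>\<in>\<vv>. \<forall>\<nu>'\<in>\<vv>. \<nu> \<le> \<nu>' \<or> \<nu>' \<le> \<nu>"
    and "\<not> (\<exists>\<nu>\<in>\<vv>. \<forall>\<nu>'\<in>\<vv>. \<nu>' \<le> \<nu>)"
    and "\<exists>f. \<not> eventually_stable \<vv> f"
    and "Polynomial.lead_coeff Q = 1" and "\<not> eventually_stable \<vv> Q"
    and "\<forall>f. Polynomial.lead_coeff f = 1 \<and> \<not> eventually_stable \<vv> f \<longrightarrow>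
           Polynomial.degree Q \<le> Polynomial.degree f"
    and "\<forall>\<nu>\<in>\<vv>. \<nu> Q < \<gamma>"
  shows "limit_augmentation \<vv> Q \<gamma> \<in> extensions \<nu>0 \<and>
    (\<forall>\<nu>\<in>\<vv>. \<nu> < limit_augmentation \<vv> Q \<gamma>) \<and>
    limit_augmentation \<vv> Q \<gamma> = truncation (limit_augmentation \<vv> Q \<gamma>) Q \<and>
    is_key_polynomial (limit_augmentation \<vv> Q \<gamma>) Q"
proof -
  interpret unstable_minimal \<nu>0 \<vv> Q \<gamma>
  proof
    fix f :: "'a poly" assume less: "Polynomial.degree f < Polynomial.degree Q"
    show "eventually_stable \<vv> f"
    proof (cases "f = 0")
      case True
      have "\<nu> f = Pinf" if "\<nu> \<in> \<vv>" for \<nu>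
        using that assms(4) True by (auto simp: extensions_def is_valuation_def)
      then show ?thesis using assms(3) unfolding eventually_stable_def by (metis all_not_in_conv)
    next
      case False
      define c where "c = Polynomial.lead_coeff f"
      define g where "g = Polynomial.smult (inverse c) f"
      have c: "c \<noteq> 0" using False by (simp add: c_def)
      have "Polynomial.lead_coeff g = 1" "Polynomial.degree g = Polynomial.degree f"
        using c by (simp_all add: g_def c_def)
      then have "eventually_stable \<vv> g" using assms(10) less by (metis not_le)
      moreover have "\<nu> f = \<nu>0 c + \<nu> g" if "\<nu> \<in> \<vv>" for \<nu>
      proof -
        have val: "is_valuation \<nu>" and c_val: "\<nu> [:c:] = \<nu>0 c"
          using that assms(4) by (auto simp: extensions_def)
        have "f = [:c:] * g" using c by (simp add: g_def)
        then show ?thesis using val_mult[OF val, of "[:c:]" g] c_val by simp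
      qed
      ultimately show ?thesis unfolding eventually_stable_def by metis
    qed
  qed (use assms(3-5,9,11) in blast)+
  have "is_key_polynomial \<mu> Q"
    unfolding is_key_polynomial_def using assms(8) degree_ge_if_delta_ge by blast
  then show ?thesis using \<mu>_extends less_\<mu> truncation_\<mu> by simp
qed

end
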